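(* Let $f:\mathbb{R}^d\to\mathbb{R}$ and $g:\mathbb{R}^d\to\mathbb{R}$, and let $f^{\vee g}:\mathbb{R}\to\overline{\mathbb{R}}$ be defined by $f^{\vee g}(s)=\sup\{f(x) : x\in\mathbb{R}^d,\ g(x)\le s\}$. Then one has $f^{\vee g}(0)=0$ and $f^{\vee g}(s)>0$ for all $s>0$ if and only if the three following conditions hold: 1. for every real $s>0$, $\{x\in\mathbb{R}^d : f(x)>0\}\cap\{x\in\mathbb{R}^d : g(x)\le s\}\neq\emptyset$; 2. the set $\{x\in\mathbb{R}^d : g(x)\le 0\}$ is nonempty and included in $\{x\in\mathbb{R}^d : f(x)\le 0\}$; 3. there exists a sequence $(x_n)_{n\in\mathbb{N}}$ in $\{x\in\mathbb{R}^d : g(x)\le 0\}$ such that $\lim_{n\to+\infty} f(x_n)=0$.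
   Context: $\overline{\mathbb{R}}=\mathbb{R}\cup\{-\infty,+\infty\}$; the supremum over the empty set is $-\infty$. *)

theory Defs
  imports "HOL-Analysis.Analysis"
begin

(* The empty supremum in ereal is -\<infinity> (bot_ereal_def), so the value is -\<infinity>
   whenever the sublevel set is empty. *)
definition sup_on_sublevel :: "('a \<Rightarrow> real) \<Rightarrow> ('a \<Rightarrow> real) \<Rightarrow> real \<Rightarrow> ereal" where
  "sup_on_sublevel f g s = (SUP x\<in>{x. g x \<le> s}. ereal (f x))"

end

theory Submission
  imports Defs
begin

text \<open>The two halves of the left-hand side translate separately. A supremum is positive iff
  some member is, so positivity for each \<open>s > 0\<close> is condition 1
  (\<open>sup_on_sublevel_pos_iff\<close>). A supremum of reals equals a real \<open>c\<close> iff
  \<open>c\<close> is an upper bound and a limit of attained values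
  (\<open>SUP_ereal_eq_real_iff\<close>); for \<open>c = 0\<close> this yields the inclusion in
  condition 2 and the sequence in condition 3.\<close>

lemma sup_on_sublevel_pos_iff:
  "sup_on_sublevel f g s > 0 \<longleftrightarrow> {x. f x > 0} \<inter> {x. g x \<le> s} \<noteq> {}"
  by (auto simp: sup_on_sublevel_def less_SUP_iff)

text \<open>Since \<open>c\<close> is finite, points of \<open>A\<close> with values arbitrarily
  close below \<open>c\<close> can be chosen; conversely, a limit of values cannot exceed the
  supremum. Having a sequence in \<open>A\<close> also excludes the empty set, whose supremum is
  \<open>-\<infinity>\<close>.\<close>

lemma SUP_ereal_eq_real_iff:
  fixes f :: "'a \<Rightarrow> real" and c :: real
  shows "(SUP x\<in>A. ereal (f x)) = ereal c \<longleftrightarrow>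
    (\<forall>x\<in>A. f x \<le> c) \<and> (\<exists>X :: nat \<Rightarrow> 'a. (\<forall>n. X n \<in> A) \<and> (\<lambda>n. f (X n)) \<longlonglongrightarrow> c)"
  (is "?S = _ \<longleftrightarrow> ?le \<and> (\<exists>X. ?seq X)")
proof
  assume S: "?S = ereal c"
  have le: "f x \<le> c" if "x \<in> A" for x
    using SUP_upper[OF that, of "\<lambda>x. ereal (f x)"] S by simp
  \<comment> \<open>\<open>Suc n\<close> matters: \<open>1 / 0 = 0\<close> would demand a value
    above \<open>c\<close>.\<close>
  have "\<exists>x\<in>A. c - 1 / Suc n < f x" for n
  proof -
    have "ereal (c - 1 / Suc n) < ?S"
      unfolding S by simp
    then show ?thesis
      by (simp only: less_SUP_iff less_ereal.simps)
  qed
  then obtain X where X: "\<And>n. X n \<in> A" "\<And>n. c - 1 / Suc n < f (X n)"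
    by metis
  have "(\<lambda>n. f (X n)) \<longlonglongrightarrow> c"
  proof (rule tendsto_sandwich)
    show "(\<lambda>n. c - 1 / Suc n) \<longlonglongrightarrow> c"
      using tendsto_diff[OF tendsto_const LIMSEQ_inverse_real_of_nat, of c]
      by (simp add: inverse_eq_divide)
  qed (use X(1) less_imp_le[OF X(2)] le in auto)
  with X(1) le show "?le \<and> (\<exists>X. ?seq X)"
    by blast
next
  assume "?le \<and> (\<exists>X. ?seq X)"
  then obtain X where le: ?le and X: "\<And>n. X n \<in> A" "(\<lambda>n. f (X n)) \<longlonglongrightarrow> c"
    by blast
  show "?S = ereal c"
  proof (rule antisym)
    show "?S \<le> ereal c"
      using le by (simp add: SUP_least)
    \<comment> \<open>The limit is taken in \<open>ereal\<close> because \<open>?S\<close> is not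
      yet known to be finite.\<close>
    have "(\<lambda>n. ereal (f (X n))) \<longlonglongrightarrow> ereal c"
      using X(2) by (rule tendsto_ereal)
    moreover have "ereal (f (X n)) \<le> ?S" for n
      using X(1) by (rule SUP_upper)
    ultimately show "ereal c \<le> ?S"
      by (rule LIMSEQ_le_const2[OF _ exI, OF _ allI, OF _ impI])
  qed
qed

theorem proposition4:
  fixes f g :: "real ^ 'd \<Rightarrow> real"
  shows "(sup_on_sublevel f g 0 = 0 \<and> (\<forall>s>0. sup_on_sublevel f g s > 0)) \<longleftrightarrow>
    ((\<forall>s::real. s > 0 \<longrightarrow> {x. f x > 0} \<inter> {x. g x \<le> s} \<noteq> {}) \<and>
     ({x. g x \<le> 0} \<noteq> {} \<and> {x. g x \<le> 0} \<subseteq> {x. f x \<le> 0}) \<and>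
     (\<exists>X :: nat \<Rightarrow> real ^ 'd. (\<forall>n. X n \<in> {x. g x \<le> 0}) \<and> (\<lambda>n. f (X n)) \<longlonglongrightarrow> 0))"
proof -
  have "sup_on_sublevel f g 0 = 0 \<longleftrightarrow> {x. g x \<le> 0} \<subseteq> {x. f x \<le> 0} \<and>
    (\<exists>X :: nat \<Rightarrow> real ^ 'd. (\<forall>n. X n \<in> {x. g x \<le> 0}) \<and> (\<lambda>n. f (X n)) \<longlonglongrightarrow> 0)"
    using SUP_ereal_eq_real_iff[of f "{x. g x \<le> 0}" 0]
    by (simp add: sup_on_sublevel_def subset_iff zero_ereal_def)
  \<comment> \<open>Nonemptiness in condition 2 is witnessed by any term of the sequence.\<close>
  then show ?thesis
    unfolding sup_on_sublevel_pos_iff by blast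
qed

end
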